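(* Let $\Pi$ be the map on $\mathbb{N}=\{1,2,3,\dots\}$ produced by the following procedure. At step $1$ set $\Pi(1)=1$. For $m=2,3,4,\dots$ in turn, at step $m$: if $\Pi(m-\lfloor m/2\rfloor)$ has not been assigned at an earlier step, set $\Pi(m-\lfloor m/2\rfloor)=m$; otherwise set $\Pi(m+\lfloor m/2\rfloor)=m$. Let $E:\mathbb{N}\to\mathbb{N}$ be defined by $E(3n+1)=9n+1$, $E(3n+2)=9n+4$, $E(3n+3)=9n+6$ for $n\ge0$. Then $\Pi(E(n))=3\Pi(n)-2$ for all $n\ge1$.
   Context: The procedure assigns a value $\Pi(n)$ to every $n\in\mathbb{N}$. *)

theory Defs
  imports Main
begin

text \<open>
  The positive integers are represented by \<^typ>\<open>nat\<close> with explicit side conditions \<open>n \<ge> 1\<close>.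
  \<open>stage m\<close> is the partial map of all assignments made in the steps \<open>1, \<dots>, m\<close>; \<^const>\<open>None\<close>
  means "not yet assigned". The subtraction below never truncates.
\<close>

definition proc_step :: "nat \<Rightarrow> (nat \<rightharpoonup> nat) \<Rightarrow> (nat \<rightharpoonup> nat)" where
  "proc_step m f =
     (if f (m - m div 2) = None then f(m - m div 2 \<mapsto> m) else f(m + m div 2 \<mapsto> m))"

fun stage :: "nat \<Rightarrow> (nat \<rightharpoonup> nat)" where
  "stage 0 = Map.empty"
| "stage (Suc 0) = [1 \<mapsto> 1]"
| "stage (Suc (Suc k)) = proc_step (Suc (Suc k)) (stage (Suc k))"

definition Pi_map :: "nat \<Rightarrow> nat" where
  "Pi_map n = (THE v. \<exists>m. stage m n = Some v)"

text \<open>The branches are \<open>n = 3 q + 1\<close>, \<open>n = 3 q + 2\<close>, \<open>n = 3 q + 3\<close>; the value at \<open>0\<close> is junk.\<close>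

definition E_map :: "nat \<Rightarrow> nat" where
  "E_map n = (let q = (n - 1) div 3 in
     if n mod 3 = 1 then 9 * q + 1 else if n mod 3 = 2 then 9 * q + 4 else 9 * q + 6)"

lemma E_map_simps:
  "E_map (3 * n + 1) = 9 * n + 1"
  "E_map (3 * n + 2) = 9 * n + 4"
  "E_map (3 * n + 3) = 9 * n + 6"
proof -
  have "(3 * n + 1) mod 3 = 1" "(3 * n + 2) mod 3 = 2" "(3 * n + 3) mod 3 = 0"
    "(3 * n + 1 - 1) div 3 = n" "(3 * n + 2 - 1) div 3 = n" "(3 * n + 3 - 1) div 3 = n"
    by presburger+
  then show "E_map (3 * n + 1) = 9 * n + 1" "E_map (3 * n + 2) = 9 * n + 4"
    "E_map (3 * n + 3) = 9 * n + 6"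
    unfolding E_map_def Let_def by (simp_all only:) simp_all
qed

text \<open>
  No position is ever assigned twice and every positive position is eventually assigned, so the
  description in \<open>Pi_map\<close> denotes the value given by the procedure.
\<close>

lemma stage_bounds:
  "(stage m p \<noteq> None \<longrightarrow> p \<le> m + m div 2) \<and> (1 \<le> p \<and> p \<le> m - m div 2 \<longrightarrow> stage m p \<noteq> None)"
proof (induction m arbitrary: p rule: stage.induct)
  case (3 k)
  let ?m = "Suc (Suc k)"
  have low: "p \<le> Suc k - Suc k div 2 \<or> p = ?m - ?m div 2" if "p \<le> ?m - ?m div 2"
    using that by presburger
  have up: "Suc k + Suc k div 2 \<le> ?m + ?m div 2" "?m - ?m div 2 \<le> ?m + ?m div 2"
    by presburger+
  show ?case
    using 3[of p] low up by (auto simp: proc_step_def split: if_splits)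
qed auto

lemma stage_mono:
  assumes "m \<le> m'" "stage m p = Some v"
  shows "stage m' p = Some v"
  using assms
proof (induction m' rule: dec_induct)
  case (step k)
  then have IH: "stage k p = Some v" by simp
  then obtain j where k: "k = Suc j" by (cases k) auto
  have "p \<le> k + k div 2" using stage_bounds[of k p] IH by simp
  then have "p \<noteq> Suc k + Suc k div 2" by presburger
  then show ?case using IH by (auto simp: k proc_step_def)
qed

lemma Pi_map_well_defined:
  assumes "1 \<le> n"
  shows "\<exists>!v. \<exists>m. stage m n = Some v"
proof -
  have "n \<le> 2 * n - 2 * n div 2" by simp
  then obtain v where v: "stage (2 * n) n = Some v"
    using stage_bounds[of "2 * n" n] assms by auto
  have "w = v" if "stage m n = Some w" for m w
    using stage_mono[OF _ that, of "max m (2 * n)"] stage_mono[OF _ v, of "max m (2 * n)"] by simp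
  then show ?thesis using v by blast
qed

end

theory Submission imports Defs begin

text \<open>
  Call a position \<open>p\<close> taken if it is filled before step \<open>2 p - 1\<close>, the first step that tries to
  move down to \<open>p\<close>. A position that is not taken receives \<open>2 p - 1\<close>, so every even \<open>m = 2 k\<close> moves
  up, to \<open>3 k\<close>, while an odd \<open>m = 2 k - 1\<close> moves up, to \<open>3 k - 2\<close>, exactly if \<open>k\<close> is taken. Hence
  \<open>3 k\<close> receives \<open>2 k\<close>, \<open>3 k + 2\<close> is never taken, and \<open>3 k + 1\<close> is taken iff \<open>k + 1\<close> is. This
  self-similarity gives the theorem, one residue class modulo 3 at a time.
\<close>

definition taken :: "nat \<Rightarrow> bool" where
  "taken p \<longleftrightarrow> stage (2 * p - 2) p \<noteq> None"

lemma stage_step: "1 \<le> m \<Longrightarrow> stage (Suc m) = proc_step (Suc m) (stage m)"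
  by (cases m) auto

lemma Pi_map_eqI: "1 \<le> p \<Longrightarrow> stage m p = Some v \<Longrightarrow> Pi_map p = v"
  unfolding Pi_map_def using Pi_map_well_defined by (intro the1_equality) auto

text \<open>Step \<open>v\<close> writes only the value \<open>v\<close>, so an entry
  \<open>v\<close> can be traced back to the branch that wrote it.\<close>

lemma stage_SomeD:
  assumes "stage m p = Some v"
  shows "v \<le> m \<and>
    (p = v - v div 2 \<or> p = v + v div 2 \<and> stage (v - 1) (v - v div 2) \<noteq> None)"
  using assms
proof (induction m rule: stage.induct)
  case (3 k)
  define m where "m = Suc (Suc k)"
  have m: "stage m = proc_step m (stage (m - 1))" "Suc k = m - 1"
    by (simp_all add: m_def)
  have "stage (m - 1) p = Some v \<or> v = m \<and>
      (p = m - m div 2 \<or> p = m + m div 2 \<and> stage (m - 1) (m - m div 2) \<noteq> None)"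
    using 3(2) unfolding m_def[symmetric] m(1) proc_step_def by (simp split: if_splits)
  then show ?case
    using 3(1) unfolding m_def[symmetric] m(2) by fastforce
qed (auto split: if_splits)

text \<open>Steps \<open>2 * k - 1\<close> and \<open>2 * k\<close> aim down at the same position
  \<open>k\<close>, so the even step finds it occupied.\<close>

lemma stage_even:
  assumes "1 \<le> k"
  shows "stage (2 * k) (3 * k) = Some (2 * k)"
proof (cases k)
  case (Suc j)
  have "stage (2 * j + 1) (Suc j) \<noteq> None"
    using stage_bounds[of "2 * j + 1" "Suc j"] by simp
  then show ?thesis
    using Suc stage_step[of "2 * j + 1"] by (auto simp: proc_step_def)
qed (use assms in simp)

lemma stage_odd:
  "stage (2 * k + 1) (if taken (k + 1) then 3 * k + 1 else k + 1) = Some (2 * k + 1)"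
proof (cases "k = 0")
  case False
  then show ?thesis
    using stage_step[of "2 * k"] by (auto simp: proc_step_def taken_def)
qed (simp add: taken_def)

lemma takenD:
  assumes "taken p"
  obtains v where "p = v + v div 2" "stage (v - 1) (v - v div 2) \<noteq> None"
proof -
  obtain v where v: "stage (2 * p - 2) p = Some v"
    using assms by (auto simp: taken_def)
  \<comment> \<open>At \<open>p = 0\<close> the index \<open>2 * p - 2\<close> truncates to 0, and
    \<open>stage 0\<close> is empty.\<close>
  have "p \<noteq> 0"
  proof
    assume "p = 0"
    with v show False by simp
  qed
  moreover have "v \<le> 2 * p - 2"
    using stage_SomeD[OF v] by blast
  \<comment> \<open>A downward move to \<open>p\<close> would have \<open>v\<close> equal to
    \<open>2 * p - 1\<close> or \<open>2 * p\<close>, which is too late.\<close>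
  ultimately have "p \<noteq> v - v div 2"
    by presburger
  then show ?thesis
    using stage_SomeD[OF v] that by blast
qed

text \<open>Upward moves miss the residue 2 modulo 3: \<open>v + v div 2\<close> is
  \<open>3 * j\<close> for \<open>v = 2 * j\<close> and \<open>3 * j + 1\<close> for
  \<open>v = 2 * j + 1\<close>.\<close>

lemma not_taken_3k2: "\<not> taken (3 * k + 2)"
proof
  assume "taken (3 * k + 2)"
  then obtain v where "3 * k + 2 = v + v div 2"
    by (rule takenD)
  then show False by presburger
qed

lemma taken_3k1_iff: "taken (3 * k + 1) \<longleftrightarrow> taken (k + 1)"
proof
  assume "taken (3 * k + 1)"
  then obtain v where v: "3 * k + 1 = v + v div 2" "stage (v - 1) (v - v div 2) \<noteq> None"
    by (rule takenD)
  from v(1) have "v = 2 * k + 1" by presburger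
  with v(2) show "taken (k + 1)" by (simp add: taken_def)
next
  assume t: "taken (k + 1)"
  \<comment> \<open>Position 1 is not taken. For positive \<open>k\<close> the upward move at step
    \<open>2 * k + 1\<close> precedes step \<open>6 * k + 1\<close>, the first to aim down at
    \<open>3 * k + 1\<close>.\<close>
  then have "k \<noteq> 0" by (cases k) (auto simp: taken_def)
  then show "taken (3 * k + 1)"
    using stage_mono[of "2 * k + 1" "6 * k" "3 * k + 1"] stage_odd[of k] t
    by (simp add: taken_def)
qed

lemma Pi_map_mult_3: "1 \<le> k \<Longrightarrow> Pi_map (3 * k) = 2 * k"
  using Pi_map_eqI[OF _ stage_even] by simp

lemma Pi_map_not_taken: "\<not> taken (k + 1) \<Longrightarrow> Pi_map (k + 1) = 2 * k + 1"
  using Pi_map_eqI[OF _ stage_odd[of k]] by simp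

lemma Pi_map_taken: "taken (k + 1) \<Longrightarrow> Pi_map (3 * k + 1) = 2 * k + 1"
  using Pi_map_eqI[OF _ stage_odd[of k]] by simp

theorem theorem3:
  fixes n :: nat
  assumes "n \<ge> 1"
  shows "int (Pi_map (E_map n)) = 3 * int (Pi_map n) - 2"
proof -
  have "n = 3 * ((n - 1) div 3) + 1 \<or> n = 3 * ((n - 1) div 3) + 2 \<or> n = 3 * ((n - 1) div 3) + 3"
    using assms by presburger
  then obtain q where "n = 3 * q + 1 \<or> n = 3 * q + 2 \<or> n = 3 * q + 3" by blast
  then consider "n = 3 * q + 1" | "n = 3 * q + 2" | "n = 3 * q + 3" by blast
  then show ?thesis
  proof cases
    case 1
    \<comment> \<open>Here \<open>E_map n = 3 * (n - 1) + 1\<close>, which is taken iff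
      \<open>n\<close> is. If so, step \<open>2 * n - 1\<close> moves up to it; otherwise
      \<open>n\<close> and \<open>E_map n\<close> each receive twice the position minus 1.\<close>
    show ?thesis
    proof (cases "taken n")
      case True
      then have "Pi_map n = 2 * q + 1"
        using 1 Pi_map_taken taken_3k1_iff by simp
      moreover have "Pi_map (9 * q + 1) = 6 * q + 1"
        using True 1 Pi_map_taken[of "3 * q"] by simp
      ultimately show ?thesis using 1 E_map_simps(1)[of q] by simp
    next
      case False
      then have "Pi_map n = 6 * q + 1"
        using 1 Pi_map_not_taken[of "3 * q"] by simp
      moreover have "Pi_map (9 * q + 1) = 18 * q + 1"
        using False 1 Pi_map_not_taken[of "9 * q"] taken_3k1_iff[of "3 * q"] by simp
      ultimately show ?thesis using 1 E_map_simps(1)[of q] by simp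
    qed
  next
    case 2
    have "Pi_map n = 6 * q + 3"
      using 2 Pi_map_not_taken[of "3 * q + 1"] not_taken_3k2[of q] by simp
    \<comment> \<open>Since \<open>9 * q + 4 = 3 * (3 * q + 1) + 1\<close>, it is taken iff
      \<open>3 * q + 2\<close> is, hence never.\<close>
    moreover have "Pi_map (9 * q + 4) = 18 * q + 7"
      using Pi_map_not_taken[of "3 * (3 * q + 1)"] taken_3k1_iff[of "3 * q + 1"] not_taken_3k2[of q]
      by (simp add: ac_simps)
    ultimately show ?thesis using 2 E_map_simps(2)[of q] by simp
  next
    case 3
    have "Pi_map n = 2 * q + 2"
      using 3 Pi_map_mult_3[of "q + 1"] by (simp add: ac_simps)
    moreover have "Pi_map (9 * q + 6) = 6 * q + 4"
      using Pi_map_mult_3[of "3 * q + 2"] by (simp add: ac_simps)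
    ultimately show ?thesis using 3 E_map_simps(3)[of q] by simp
  qed
qed

end
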